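(* Let $n\ge 1$, let $\Omega\subset\mathbb{R}^{n+1}$ be a domain, and let $\mathcal{A}_n(2,\alpha_j,\gamma_{ij})$ be the Clifford-type algebra with constant real parameters $\alpha_j$, $\gamma_{ij}=\gamma_{ji}$. Let $$\mathcal{F}u=\sum_{i=0}^{n}A^{(i)}\,\partial_iu ,$$ where the coefficients $A^{(i)}=A^{(i)}(x_i)$, $i=0,\dots,n$, are arbitrarily given real-valued functions of class $C^1$, each $A^{(i)}$ depending only on the variable $x_i$. Let $\lambda_0,\dots,\lambda_n:\Omega\to\mathbb{R}$ be functions of class $C^1$ with $\lambda_0(x)\ne0$ for all $x\in\Omega$, let $\mathbf{D}u=\sum_{j=0}^{n}\lambda_j(x)\,e_j\,\partial_ju$, and put $\beta_i=\lambda_i/\lambda_0$ for $i=1,\dots,n$. Suppose that for every $i=1,\dots,n$, in $\Omega$, $$\beta_i\left(\partial_iA^{(i)}-\partial_0A^{(0)}\right)-\sum_{j=0}^{n}A^{(j)}\,\partial_j\beta_i=0 .$$ Then $\mathcal{F}$ is associated to $\mathbf{D}$, i.e. for every $u:\Omega\to\mathcal{A}_n(2,\alpha_j,\gamma_{ij})$ of class $C^2$, $\mathbf{D}u=0$ in $\Omega$ implies $\mathbf{D}(\mathcal{F}u)=0$ in $\Omega$.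
   Context: The algebra $\mathcal{A}_n(2,\alpha_j,\gamma_{ij})$, with real constants $\alpha_1,\dots,\alpha_n$ and $\gamma_{ij}=\gamma_{ji}$ ($i\ne j$), is the associative unital real algebra generated by $e_1,\dots,e_n$ subject to $e_j^2=-\alpha_j$ and $e_ie_j+e_je_i=2\gamma_{ij}$ for $i\neq j$. It has dimension $2^n$, with basis $e_A$, $A\in\Gamma=\{0,1,\dots,n,12,\dots,12\ldots n\}$, where $e_0=1$ and $e_{i_1i_2\ldots i_k}=e_{i_1}e_{i_2}\cdots e_{i_k}$ for $i_1<\dots<i_k$. Points of $\mathbb{R}^{n+1}$ are $x=(x_0,\dots,x_n)$ and $\partial_j$ denotes differentiation with respect to $x_j$. A function $u=\sum_{A\in\Gamma}u_Ae_A$ with real-valued $u_A$ is of class $C^k$ if every $u_A$ is; derivatives act componentwise. The products in $\mathbf{D}u$ are products in the algebra in the order written. The operator $\mathbf{D}$ is called a generalized Cauchy-Riemann operator. Operators $\mathcal{F}$ and $\mathbf{D}$ are called associated if $\mathbf{D}u=0$ implies $\mathbf{D}(\mathcal{F}u)=0$. *)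

theory Defs
  imports
    "HOL-Analysis.Analysis"
    "HOL-Algebra.QuotRing"
    "HOL-Algebra.Algebraic_Closure_Type"
    "HOL-Library.Poly_Mapping"
begin

section \<open>Clifford-type algebras with parameters\<close>

text \<open>
  Words over the alphabet \<open>'n\<close>, with concatenation written additively: then the type of finitely
  supported functions \<open>'n word \<Rightarrow>\<^sub>0 real\<close>, with its convolution product, is the free associative
  unital real algebra on \<open>'n\<close> (noncommutative polynomials).
\<close>

datatype 'n word = Word (letters: "'n list")

instantiation word :: (type) monoid_add
begin

definition zero_word :: "'a word" where
  "0 = Word []"

definition plus_word :: "'a word \<Rightarrow> 'a word \<Rightarrow> 'a word" where
  "v + w = Word (letters v @ letters w)"

instance
  by standard (simp_all add: zero_word_def plus_word_def)

end

type_synonym 'n free_algebra = "'n word \<Rightarrow>\<^sub>0 real"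

definition free_const :: "real \<Rightarrow> 'n free_algebra" where
  "free_const r = Poly_Mapping.single 0 r"

definition free_var :: "'n \<Rightarrow> 'n free_algebra" where
  "free_var j = Poly_Mapping.single (Word [j]) 1"

text \<open>
  The relations \<open>e\<^sub>j\<^sup>2 = - \<alpha>\<^sub>j\<close> and \<open>e\<^sub>i e\<^sub>j + e\<^sub>j e\<^sub>i = 2 \<gamma>\<^sub>i\<^sub>j\<close> (\<open>i \<noteq> j\<close>). The diagonal values of \<open>\<gamma>\<close>
  are never used.
\<close>

definition clifford_relators ::
    "('n \<Rightarrow> real) \<Rightarrow> ('n \<Rightarrow> 'n \<Rightarrow> real) \<Rightarrow> 'n free_algebra set" where
  "clifford_relators \<alpha> \<gamma> =
     {free_var j * free_var j + free_const (\<alpha> j) | j. True} \<union>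
     {free_var i * free_var j + free_var j * free_var i - free_const (2 * \<gamma> i j) | i j. i \<noteq> j}"

text \<open>
  \<open>Idl\<close> is the generated two-sided ideal, so the elements of the following algebra are cosets in
  the free algebra.
\<close>

definition clifford_ideal ::
    "('n \<Rightarrow> real) \<Rightarrow> ('n \<Rightarrow> 'n \<Rightarrow> real) \<Rightarrow> 'n free_algebra set" where
  "clifford_ideal \<alpha> \<gamma> = Idl\<^bsub>ring_of_type_algebra\<^esub> (clifford_relators \<alpha> \<gamma>)"

definition clifford_algebra ::
    "('n \<Rightarrow> real) \<Rightarrow> ('n \<Rightarrow> 'n \<Rightarrow> real) \<Rightarrow> 'n free_algebra set ring" where
  "clifford_algebra \<alpha> \<gamma> = ring_of_type_algebra Quot clifford_ideal \<alpha> \<gamma>"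

definition clifford_class ::
    "('n \<Rightarrow> real) \<Rightarrow> ('n \<Rightarrow> 'n \<Rightarrow> real) \<Rightarrow> 'n free_algebra \<Rightarrow> 'n free_algebra set" where
  "clifford_class \<alpha> \<gamma> p = clifford_ideal \<alpha> \<gamma> +>\<^bsub>ring_of_type_algebra\<^esub> p"

definition clifford_scale ::
    "('n \<Rightarrow> real) \<Rightarrow> ('n \<Rightarrow> 'n \<Rightarrow> real) \<Rightarrow> real \<Rightarrow> 'n free_algebra set \<Rightarrow> 'n free_algebra set" where
  "clifford_scale \<alpha> \<gamma> r v = clifford_class \<alpha> \<gamma> (free_const r) \<otimes>\<^bsub>clifford_algebra \<alpha> \<gamma>\<^esub> v"

text \<open>
  The index set \<open>{0, 1, \<dots>, n}\<close> is represented by \<open>'n option\<close>, where \<open>'n\<close> is a finite linearly ordered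
  type with \<open>n\<close> elements: \<open>None\<close> is the index \<open>0\<close>, and \<open>e\<^sub>0 = 1\<close>.
\<close>

fun clifford_gen ::
    "('n \<Rightarrow> real) \<Rightarrow> ('n \<Rightarrow> 'n \<Rightarrow> real) \<Rightarrow> 'n option \<Rightarrow> 'n free_algebra set" where
  "clifford_gen \<alpha> \<gamma> None = \<one>\<^bsub>clifford_algebra \<alpha> \<gamma>\<^esub>"
| "clifford_gen \<alpha> \<gamma> (Some j) = clifford_class \<alpha> \<gamma> (free_var j)"

text \<open>
  \<open>e\<^sub>A = e\<^bsub>i1\<^esub> \<cdots> e\<^bsub>ik\<^esub>\<close> for \<open>A = {i1 < \<dots> < ik}\<close>; the empty set is the index \<open>0\<close> of \<open>\<Gamma>\<close>.
\<close>

definition clifford_basis ::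
    "('n::linorder \<Rightarrow> real) \<Rightarrow> ('n \<Rightarrow> 'n \<Rightarrow> real) \<Rightarrow> 'n set \<Rightarrow> 'n free_algebra set" where
  "clifford_basis \<alpha> \<gamma> A =
     foldr (\<lambda>j v. clifford_gen \<alpha> \<gamma> (Some j) \<otimes>\<^bsub>clifford_algebra \<alpha> \<gamma>\<^esub> v)
       (sorted_list_of_set A) \<one>\<^bsub>clifford_algebra \<alpha> \<gamma>\<^esub>"

definition clifford_comb ::
    "('n::{finite,linorder} \<Rightarrow> real) \<Rightarrow> ('n \<Rightarrow> 'n \<Rightarrow> real) \<Rightarrow> ('n set \<Rightarrow> real) \<Rightarrow> 'n free_algebra set"
  where
  "clifford_comb \<alpha> \<gamma> c =
     (\<Oplus>\<^bsub>clifford_algebra \<alpha> \<gamma>\<^esub> A\<in>UNIV. clifford_scale \<alpha> \<gamma> (c A) (clifford_basis \<alpha> \<gamma> A))"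

text \<open>
  The components \<open>u\<^sub>A\<close> of an element \<open>v = (\<Sum>A. u\<^sub>A e\<^sub>A)\<close>. For \<open>\<gamma>\<close> symmetric off the diagonal, the
  \<open>e\<^sub>A\<close> form a basis of the algebra, so the description is proper on the carrier.
\<close>

definition clifford_coord ::
    "('n::{finite,linorder} \<Rightarrow> real) \<Rightarrow> ('n \<Rightarrow> 'n \<Rightarrow> real) \<Rightarrow> 'n free_algebra set \<Rightarrow> 'n set \<Rightarrow> real"
  where
  "clifford_coord \<alpha> \<gamma> v = (THE c. v = clifford_comb \<alpha> \<gamma> c)"


section \<open>Partial derivatives and functions of class \<open>C\<^sup>k\<close>\<close>

definition partial :: "'m::finite \<Rightarrow> (real ^ 'm \<Rightarrow> real) \<Rightarrow> real ^ 'm \<Rightarrow> real" where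
  "partial j f x = deriv (\<lambda>t. f (x + t *\<^sub>R axis j 1)) 0"

fun class_C :: "nat \<Rightarrow> (real ^ 'm::finite) set \<Rightarrow> (real ^ 'm \<Rightarrow> real) \<Rightarrow> bool" where
  "class_C 0 \<Omega> f \<longleftrightarrow> continuous_on \<Omega> f"
| "class_C (Suc k) \<Omega> f \<longleftrightarrow>
     continuous_on \<Omega> f \<and>
     (\<forall>j. (\<forall>x\<in>\<Omega>. (\<lambda>t. f (x + t *\<^sub>R axis j 1)) differentiable (at 0)) \<and>
          class_C k \<Omega> (partial j f))"

definition clifford_class_C ::
    "('n::{finite,linorder} \<Rightarrow> real) \<Rightarrow> ('n \<Rightarrow> 'n \<Rightarrow> real) \<Rightarrow> nat \<Rightarrow> (real ^ 'n option) set \<Rightarrow>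
     (real ^ 'n option \<Rightarrow> 'n free_algebra set) \<Rightarrow> bool" where
  "clifford_class_C \<alpha> \<gamma> k \<Omega> u \<longleftrightarrow>
     (\<forall>x\<in>\<Omega>. u x \<in> carrier (clifford_algebra \<alpha> \<gamma>)) \<and>
     (\<forall>A. class_C k \<Omega> (\<lambda>x. clifford_coord \<alpha> \<gamma> (u x) A))"

definition clifford_partial ::
    "('n::{finite,linorder} \<Rightarrow> real) \<Rightarrow> ('n \<Rightarrow> 'n \<Rightarrow> real) \<Rightarrow> 'n option \<Rightarrow>
     (real ^ 'n option \<Rightarrow> 'n free_algebra set) \<Rightarrow> real ^ 'n option \<Rightarrow> 'n free_algebra set" where
  "clifford_partial \<alpha> \<gamma> j u x =
     clifford_comb \<alpha> \<gamma> (\<lambda>A. partial j (\<lambda>y. clifford_coord \<alpha> \<gamma> (u y) A) x)"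


section \<open>The operators\<close>

definition cauchy_riemann_op ::
    "('n::{finite,linorder} \<Rightarrow> real) \<Rightarrow> ('n \<Rightarrow> 'n \<Rightarrow> real) \<Rightarrow>
     ('n option \<Rightarrow> real ^ 'n option \<Rightarrow> real) \<Rightarrow>
     (real ^ 'n option \<Rightarrow> 'n free_algebra set) \<Rightarrow> real ^ 'n option \<Rightarrow> 'n free_algebra set" where
  "cauchy_riemann_op \<alpha> \<gamma> lam u x =
     (\<Oplus>\<^bsub>clifford_algebra \<alpha> \<gamma>\<^esub> j\<in>UNIV.
        clifford_scale \<alpha> \<gamma> (lam j x)
          (clifford_gen \<alpha> \<gamma> j \<otimes>\<^bsub>clifford_algebra \<alpha> \<gamma>\<^esub> clifford_partial \<alpha> \<gamma> j u x))"

definition first_order_op ::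
    "('n::{finite,linorder} \<Rightarrow> real) \<Rightarrow> ('n \<Rightarrow> 'n \<Rightarrow> real) \<Rightarrow>
     ('n option \<Rightarrow> real ^ 'n option \<Rightarrow> real) \<Rightarrow>
     (real ^ 'n option \<Rightarrow> 'n free_algebra set) \<Rightarrow> real ^ 'n option \<Rightarrow> 'n free_algebra set" where
  "first_order_op \<alpha> \<gamma> a u x =
     (\<Oplus>\<^bsub>clifford_algebra \<alpha> \<gamma>\<^esub> i\<in>UNIV. clifford_scale \<alpha> \<gamma> (a i x) (clifford_partial \<alpha> \<gamma> i u x))"

definition associated_operators ::
    "('n::{finite,linorder} \<Rightarrow> real) \<Rightarrow> ('n \<Rightarrow> 'n \<Rightarrow> real) \<Rightarrow> (real ^ 'n option) set \<Rightarrow>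
     ((real ^ 'n option \<Rightarrow> 'n free_algebra set) \<Rightarrow> real ^ 'n option \<Rightarrow> 'n free_algebra set) \<Rightarrow>
     ((real ^ 'n option \<Rightarrow> 'n free_algebra set) \<Rightarrow> real ^ 'n option \<Rightarrow> 'n free_algebra set) \<Rightarrow>
     bool" where
  "associated_operators \<alpha> \<gamma> \<Omega> F D \<longleftrightarrow>
     (\<forall>u. clifford_class_C \<alpha> \<gamma> 2 \<Omega> u \<longrightarrow>
        (\<forall>x\<in>\<Omega>. D u x = \<zero>\<^bsub>clifford_algebra \<alpha> \<gamma>\<^esub>) \<longrightarrow>
        (\<forall>x\<in>\<Omega>. D (F u) x = \<zero>\<^bsub>clifford_algebra \<alpha> \<gamma>\<^esub>))"

end

theory Submission
  imports Defs
begin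

text \<open>
  Write \<open>\<beta>\<^sub>0 = 1\<close>. Since \<open>\<lambda>\<^sub>0\<close> has no zeros, \<open>\<D> u = 0\<close> says that \<open>(\<Sum>j. \<beta>\<^sub>j e\<^sub>j \<partial>\<^sub>j u) = 0\<close>. Differentiating this
  equation in direction \<open>i\<close>, multiplying by \<open>a\<^sub>i\<close> and summing over \<open>i\<close> gives an equation with the same
  second-order terms as \<open>(\<Sum>j. \<beta>\<^sub>j e\<^sub>j \<partial>\<^sub>j (\<F> u))\<close>, by symmetry of the second derivatives. In the difference
  the factor of \<open>e\<^sub>j \<partial>\<^sub>j u\<close> is \<open>\<beta>\<^sub>j \<partial>\<^sub>j a\<^sub>j - (\<Sum>i. a\<^sub>i \<partial>\<^sub>i \<beta>\<^sub>j)\<close>, because \<open>a\<^sub>j\<close> depends on \<open>x\<^sub>j\<close> only, and by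
  hypothesis this factor equals \<open>\<beta>\<^sub>j \<partial>\<^sub>0 a\<^sub>0\<close>. So the difference is \<open>\<partial>\<^sub>0 a\<^sub>0\<close> times the original equation,
  which vanishes.

  Derivatives are taken of the coordinates with respect to the elements \<open>e\<^sub>A\<close>, so the calculation
  presupposes that these are linearly independent (\<open>clifford_coord_comb\<close>). This is shown by letting the
  algebra act on the exterior algebra: \<open>e\<^sub>j\<close> acts as the exterior product with the \<open>j\<close>-th basis vector plus
  the contraction with \<open>B j\<close>, for a bilinear form \<open>B\<close>. The Clifford relations depend only on
  \<open>B i j + B j i\<close> (\<open>clifford_op_anticommute\<close>), so \<open>B\<close> may be chosen triangular, and then \<open>e\<^sub>A\<close> maps the vacuum
  exactly to the basis vector of index \<open>A\<close> (\<open>word_action_axis\<close>), whatever the parameters are.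

  Differentiation of \<open>\<D> u = 0\<close> is carried out on coefficient vectors: these lie in the subspace of
  linear relations between the products \<open>e\<^sub>j e\<^sub>A\<close> (\<open>cauchy_riemann_op_eq_zero_iff\<close>), and a subspace contains
  the derivative of any curve in it (\<open>derivative_in_subspace\<close>). The symmetry of second derivatives is
  proved from the definition by partial derivatives (\<open>partial_commute\<close>).
\<close>

section \<open>Partial derivatives\<close>

lemma partial_eqI:
  assumes "((\<lambda>t. f (x + t *\<^sub>R axis j 1)) has_real_derivative d) (at 0)"
  shows "partial j f x = d"
  unfolding partial_def using assms by (rule DERIV_imp_deriv)

lemma class_C_has_partial:
  assumes "class_C (Suc k) \<Omega> f" "x \<in> \<Omega>"
  shows "((\<lambda>t. f (x + t *\<^sub>R axis j 1)) has_real_derivative partial j f x) (at 0)"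
  using assms unfolding partial_def by (simp add: DERIV_deriv_iff_real_differentiable)

text \<open>
  The mean value theorem needs derivatives along a whole segment in a coordinate direction; they are
  the partial derivatives at the shifted base points.
\<close>

lemma class_C_has_partial_on_line:
  assumes "class_C (Suc k) \<Omega> f" "x + s *\<^sub>R axis j 1 \<in> \<Omega>"
  shows "((\<lambda>t. f (x + t *\<^sub>R axis j 1)) has_real_derivative partial j f (x + s *\<^sub>R axis j 1)) (at s)"
  using class_C_has_partial[OF assms, of j]
    DERIV_shift[of "\<lambda>t. f (x + t *\<^sub>R axis j 1)" "partial j f (x + s *\<^sub>R axis j 1)" 0 s]
  by (simp add: algebra_simps)

text \<open>
  The second difference over a square of side \<open>h\<close> does not change when the two directions are swapped,
  so evaluating it by the mean value theorem, first in direction \<open>i\<close> and then in direction \<open>j\<close>,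
  will make the two mixed partial derivatives comparable.
\<close>

lemma second_difference_mean_value:
  assumes C: "class_C 2 \<Omega> f" and "h > 0"
    and square: "\<And>s t. 0 \<le> s \<Longrightarrow> s \<le> h \<Longrightarrow> 0 \<le> t \<Longrightarrow> t \<le> h \<Longrightarrow> x + s *\<^sub>R axis i 1 + t *\<^sub>R axis j 1 \<in> \<Omega>"
  shows "\<exists>s t. 0 \<le> s \<and> s \<le> h \<and> 0 \<le> t \<and> t \<le> h \<and>
    f (x + h *\<^sub>R axis i 1 + h *\<^sub>R axis j 1) - f (x + h *\<^sub>R axis i 1) - f (x + h *\<^sub>R axis j 1) + f x
      = h\<^sup>2 * partial j (partial i f) (x + s *\<^sub>R axis i 1 + t *\<^sub>R axis j 1)"
proof -
  let ?p = "\<lambda>s t. x + s *\<^sub>R axis i 1 + t *\<^sub>R axis j 1"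
  have Cf: "class_C (Suc 1) \<Omega> f" and Cp: "class_C (Suc 0) \<Omega> (partial i f)"
    using C by (simp_all add: numeral_2_eq_2)
  have fi: "((\<lambda>s. f (?p s t)) has_real_derivative partial i f (?p s t)) (at s)"
    if "0 \<le> s" "s \<le> h" "0 \<le> t" "t \<le> h" for s t
    using class_C_has_partial_on_line[OF Cf, of "x + t *\<^sub>R axis j 1" s i] square[OF that]
    by (simp add: add_ac)
  have "\<exists>s>0. s < h \<and> (f (?p h h) - f (?p h 0)) - (f (?p 0 h) - f (?p 0 0))
      = (h - 0) * (partial i f (?p s h) - partial i f (?p s 0))"
    using \<open>h > 0\<close> fi[of _ 0] by (intro MVT2) (auto intro!: DERIV_diff fi)
  then obtain s where s: "0 < s" "s < h" "(f (?p h h) - f (?p h 0)) - (f (?p 0 h) - f (?p 0 0))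
      = h * (partial i f (?p s h) - partial i f (?p s 0))" by auto
  have "\<exists>t>0. t < h \<and> partial i f (?p s h) - partial i f (?p s 0)
      = (h - 0) * partial j (partial i f) (?p s t)"
    using \<open>h > 0\<close> s square by (intro MVT2) (auto intro!: class_C_has_partial_on_line[OF Cp])
  then obtain t where t: "0 < t" "t < h" "partial i f (?p s h) - partial i f (?p s 0)
      = h * partial j (partial i f) (?p s t)" by auto
  from s(3) have "f (?p h h) - f (?p h 0) - f (?p 0 h) + f (?p 0 0)
      = h\<^sup>2 * partial j (partial i f) (?p s t)"
    unfolding t(3) by (simp add: power2_eq_square)
  with s t show ?thesis by (intro exI[of _ s] exI[of _ t]) simp
qed

text \<open>
  Schwarz's theorem: applied in both orders, the mean value formula for the same second difference
  produces points arbitrarily close to \<open>x\<close> at which the two mixed derivatives agree, and both are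
  continuous at \<open>x\<close>.
\<close>

lemma partial_commute:
  assumes "open \<Omega>" and C: "class_C 2 \<Omega> f" and x: "x \<in> \<Omega>"
  shows "partial i (partial j f) x = partial j (partial i f) x"
proof -
  let ?P = "partial j (partial i f)" and ?Q = "partial i (partial j f)"
  have "isCont ?P x" "isCont ?Q x"
    using C assms by (auto simp: numeral_2_eq_2 continuous_on_eq_continuous_at)
  have "\<bar>?Q x - ?P x\<bar> \<le> e" if "e > 0" for e
  proof -
    obtain d1 where d1: "d1 > 0" "\<And>y. dist y x < d1 \<Longrightarrow> \<bar>?P y - ?P x\<bar> < e / 2"
      using \<open>isCont ?P x\<close> \<open>e > 0\<close> unfolding continuous_at_eps_delta dist_real_def
      by (meson half_gt_zero)
    obtain d2 where d2: "d2 > 0" "\<And>y. dist y x < d2 \<Longrightarrow> \<bar>?Q y - ?Q x\<bar> < e / 2"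
      using \<open>isCont ?Q x\<close> \<open>e > 0\<close> unfolding continuous_at_eps_delta dist_real_def
      by (meson half_gt_zero)
    obtain d3 where d3: "d3 > 0" "\<And>y. dist y x < d3 \<Longrightarrow> y \<in> \<Omega>"
      using \<open>open \<Omega>\<close> x unfolding open_dist by blast
    define h where "h = min d1 (min d2 d3) / 3"
    have h: "h > 0" using d1 d2 d3 by (simp add: h_def)
    have near: "dist (x + s *\<^sub>R axis k 1 + t *\<^sub>R axis l 1) x < min d1 (min d2 d3)"
      if "0 \<le> s" "s \<le> h" "0 \<le> t" "t \<le> h" for s t k l
    proof -
      have "dist (x + s *\<^sub>R axis k 1 + t *\<^sub>R axis l 1) x = norm (s *\<^sub>R axis k 1 + t *\<^sub>R axis l (1::real))"
        by (simp add: dist_norm algebra_simps)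
      also have "\<dots> \<le> norm (s *\<^sub>R axis k (1::real)) + norm (t *\<^sub>R axis l (1::real))"
        by (rule norm_triangle_ineq)
      also have "\<dots> = s + t" using that by (simp add: norm_axis_1)
      also have "\<dots> < 3 * h" using that h by simp
      finally show ?thesis by (simp add: h_def)
    qed
    obtain s t where st: "0 \<le> s" "s \<le> h" "0 \<le> t" "t \<le> h"
      "f (x + h *\<^sub>R axis i 1 + h *\<^sub>R axis j 1) - f (x + h *\<^sub>R axis i 1) - f (x + h *\<^sub>R axis j 1) + f x
      = h\<^sup>2 * ?P (x + s *\<^sub>R axis i 1 + t *\<^sub>R axis j 1)"
      using second_difference_mean_value[OF C h, of x i j] near d3 by (metis min_less_iff_conj)
    obtain s' t' where st': "0 \<le> s'" "s' \<le> h" "0 \<le> t'" "t' \<le> h"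
      "f (x + h *\<^sub>R axis j 1 + h *\<^sub>R axis i 1) - f (x + h *\<^sub>R axis j 1) - f (x + h *\<^sub>R axis i 1) + f x
      = h\<^sup>2 * ?Q (x + s' *\<^sub>R axis j 1 + t' *\<^sub>R axis i 1)"
      using second_difference_mean_value[OF C h, of x j i] near d3 by (metis min_less_iff_conj)
    have "f (x + h *\<^sub>R axis i 1 + h *\<^sub>R axis j 1) = f (x + h *\<^sub>R axis j 1 + h *\<^sub>R axis i 1)"
      by (simp add: add_ac)
    then have "h\<^sup>2 * ?P (x + s *\<^sub>R axis i 1 + t *\<^sub>R axis j 1) = h\<^sup>2 * ?Q (x + s' *\<^sub>R axis j 1 + t' *\<^sub>R axis i 1)"
      using st(5) st'(5) by linarith
    then have "?P (x + s *\<^sub>R axis i 1 + t *\<^sub>R axis j 1) = ?Q (x + s' *\<^sub>R axis j 1 + t' *\<^sub>R axis i 1)"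
      using h by simp
    moreover have "\<bar>?P (x + s *\<^sub>R axis i 1 + t *\<^sub>R axis j 1) - ?P x\<bar> < e / 2"
      using d1(2) near[OF st(1-4)] by simp
    moreover have "\<bar>?Q (x + s' *\<^sub>R axis j 1 + t' *\<^sub>R axis i 1) - ?Q x\<bar> < e / 2"
      using d2(2) near[OF st'(1-4)] by simp
    ultimately show ?thesis by linarith
  qed
  then have "\<bar>?Q x - ?P x\<bar> \<le> 0" by (rule field_le_epsilon) auto
  then show ?thesis by simp
qed

text \<open>
  Subspaces of a finite-dimensional space are closed, so they contain the limits of the difference
  quotients of a curve that runs inside them. This is what allows a linear relation between the
  partial derivatives to be differentiated without knowing a basis of the space of relations.
\<close>

lemma derivative_in_subspace:
  fixes W :: "real \<Rightarrow> real ^ 'm::finite"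
  assumes K: "subspace K" and W: "\<forall>\<^sub>F s in nhds t. W s \<in> K"
    and d: "\<And>p. ((\<lambda>s. W s $ p) has_real_derivative d $ p) (at t)"
  shows "d \<in> K"
proof (rule Lim_in_closed_set)
  show "closed K" using K by (rule closed_subspace)
  have "W t \<in> K" using W by (rule eventually_nhds_x_imp_x)
  have "\<forall>\<^sub>F s in at t. W s \<in> K"
    unfolding eventually_at_filter using W by eventually_elim simp
  then show "\<forall>\<^sub>F s in at t. (1 / (s - t)) *\<^sub>R (W s - W t) \<in> K"
    by eventually_elim (intro subspace_scale subspace_diff K \<open>W t \<in> K\<close>)
  show "((\<lambda>s. (1 / (s - t)) *\<^sub>R (W s - W t)) \<longlongrightarrow> d) (at t)"
    using d by (intro vec_tendstoI) (simp add: has_field_derivative_iff)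
qed simp

lemma open_line_eventually:
  fixes x e :: "'a::real_normed_vector"
  assumes "open \<Omega>" "x \<in> \<Omega>"
  shows "\<forall>\<^sub>F t in nhds (0::real). x + t *\<^sub>R e \<in> \<Omega>"
proof -
  have "((\<lambda>t::real. x + t *\<^sub>R e) \<longlongrightarrow> x + 0 *\<^sub>R e) (nhds 0)"
    by (intro tendsto_intros filterlim_ident)
  then show ?thesis using assms by (auto intro: topological_tendstoD)
qed

text \<open>
  In the open set, a short segment in direction \<open>j\<close> leaves the coordinate \<open>i\<close> unchanged,
  and so \<open>f\<close> is constant along it.
\<close>

lemma partial_eq_0_of_other_variable:
  fixes f :: "real ^ 'm::finite \<Rightarrow> real"
  assumes "open \<Omega>" "x \<in> \<Omega>" "i \<noteq> j"
    and "\<And>x y. x \<in> \<Omega> \<Longrightarrow> y \<in> \<Omega> \<Longrightarrow> x $ i = y $ i \<Longrightarrow> f x = f y"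
  shows "partial j f x = 0"
proof (rule partial_eqI)
  have "\<forall>\<^sub>F t in nhds 0. f (x + t *\<^sub>R axis j 1) = f x"
    using open_line_eventually[OF assms(1,2), of "axis j 1"]
  proof eventually_elim
    case (elim t)
    show ?case using assms(2,3) elim by (intro assms(4)) (auto simp: axis_def)
  qed
  then show "((\<lambda>t. f (x + t *\<^sub>R axis j 1)) has_real_derivative 0) (at 0)"
    using DERIV_cong_ev[of 0 0 "\<lambda>t. f (x + t *\<^sub>R axis j 1)" "\<lambda>t. f x" 0 0] by simp
qed

lemma has_partial_divide:
  assumes "class_C 1 \<Omega> f" "class_C 1 \<Omega> g" "x \<in> \<Omega>" "g x \<noteq> 0"
  shows "((\<lambda>t. f (x + t *\<^sub>R axis i 1) / g (x + t *\<^sub>R axis i 1))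
    has_real_derivative partial i (\<lambda>x. f x / g x) x) (at 0)"
proof -
  have "(\<lambda>t. f (x + t *\<^sub>R axis i 1) / g (x + t *\<^sub>R axis i 1)) differentiable (at 0)"
    using assms by (intro differentiable_divide) auto
  then show ?thesis
    unfolding partial_def by (simp add: DERIV_deriv_iff_real_differentiable)
qed

section \<open>A representation on the exterior algebra\<close>

text \<open>
  Vectors of \<open>real ^ 'n set\<close> are elements of the exterior algebra on \<open>'n\<close>, the axis \<open>A\<close> standing for
  the increasing wedge product of the members of \<open>A\<close>. The sign is the one that arises when \<open>k\<close> is moved
  to its place among the members of the index set.
\<close>

definition crossing_sign :: "'n::{finite,linorder} \<Rightarrow> 'n set \<Rightarrow> real" where
  "crossing_sign k Y = (-1) ^ card {l \<in> Y. l < k}"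

lemma crossing_sign_insert:
  "crossing_sign k (insert l Y) =
     (if l < k \<and> l \<notin> Y then - crossing_sign k Y else crossing_sign k Y)"
proof -
  have "{m \<in> insert l Y. m < k} =
      (if l < k then insert l {m \<in> Y. m < k} else {m \<in> Y. m < k})" by auto
  then show ?thesis
    by (auto simp: crossing_sign_def insert_absorb)
qed

lemma crossing_sign_delete:
  "crossing_sign k (Y - {l}) =
     (if l < k \<and> l \<in> Y then - crossing_sign k Y else crossing_sign k Y)"
proof (cases "l \<in> Y")
  case True
  then have "Y = insert l (Y - {l})" by blast
  then have "crossing_sign k Y = (if l < k then - crossing_sign k (Y - {l}) else crossing_sign k (Y - {l}))"
    using crossing_sign_insert[of k l "Y - {l}"] by (metis DiffD2 singletonI)
  then show ?thesis using True by auto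
qed auto

lemma crossing_sign_square: "crossing_sign k Y * crossing_sign k Y = 1"
  by (simp add: crossing_sign_def flip: power_mult_distrib)

lemma crossing_sign_square': "crossing_sign k Y * (crossing_sign k Y * c) = c"
  by (metis crossing_sign_square mult.assoc mult_1)

text \<open>
  Left multiplication by the basis vector \<open>k\<close> in the exterior algebra.
\<close>

definition creation :: "'n::{finite,linorder} \<Rightarrow> real ^ 'n set \<Rightarrow> real ^ 'n set" where
  "creation k f = (\<chi> Y. if k \<in> Y then crossing_sign k Y * f $ (Y - {k}) else 0)"

text \<open>
  Contraction with the dual basis vector of \<open>k\<close>, the transpose of \<open>creation k\<close>.
\<close>

definition annihilation :: "'n::{finite,linorder} \<Rightarrow> real ^ 'n set \<Rightarrow> real ^ 'n set" where
  "annihilation k f = (\<chi> Y. if k \<in> Y then 0 else crossing_sign k Y * f $ insert k Y)"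

lemma linear_creation: "linear (creation k)"
  by (rule linearI) (auto simp: creation_def vec_eq_iff algebra_simps)

lemma linear_annihilation: "linear (annihilation k)"
  by (rule linearI) (auto simp: annihilation_def vec_eq_iff algebra_simps)

text \<open>
  The three canonical anticommutation relations. They come from the fact that inserting or deleting
  \<open>l\<close> flips the sign of \<open>k\<close> exactly when \<open>l < k\<close>, so that for two distinct indices just one of the two
  orders of application picks up an extra sign. For a creation and an annihilation with the same
  index \<open>k\<close>, one order restores the components of the sets that contain \<open>k\<close>, the other order
  those of the sets that do not.
\<close>

lemma creation_creation:
  "creation i (creation j f) + creation j (creation i f) = 0"
  by (cases i j rule: linorder_cases)
    (auto simp: vec_eq_iff creation_def crossing_sign_delete Diff_insert2[symmetric] insert_commute)

lemma annihilation_annihilation: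
  "annihilation i (annihilation j f) + annihilation j (annihilation i f) = 0"
  by (cases i j rule: linorder_cases)
    (auto simp: vec_eq_iff annihilation_def crossing_sign_insert insert_commute)

lemma creation_annihilation:
  "creation i (annihilation k f) + annihilation k (creation i f) = (if i = k then f else 0)"
proof -
  have swap: "insert k (Y - {i}) = insert k Y - {i}" if "i \<noteq> k" for Y using that by auto
  show ?thesis
    by (cases i k rule: linorder_cases)
      (auto simp: vec_eq_iff creation_def annihilation_def crossing_sign_insert crossing_sign_delete
         swap insert_absorb crossing_sign_square')
qed

text \<open>
  Wedge multiplication by \<open>j\<close> plus contraction with the linear form \<open>B j\<close>.
  This is the usual action of a Clifford algebra on the exterior algebra, for a bilinear form \<open>B\<close> that
  may be unsymmetric.
\<close>

definition clifford_op ::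
    "('n \<Rightarrow> 'n \<Rightarrow> real) \<Rightarrow> 'n::{finite,linorder} \<Rightarrow> real ^ 'n set \<Rightarrow> real ^ 'n set" where
  "clifford_op B j f = creation j f + (\<Sum>k\<in>UNIV. B j k *\<^sub>R annihilation k f)"

lemma linear_clifford_op: "linear (clifford_op B j)"
  unfolding clifford_op_def
  by (intro linear_compose_add linear_creation linear_compose_sum ballI linear_compose_scale_right
        linear_annihilation)

text \<open>
  Two wedge products anticommute, and so do two contractions; what remains are the mixed terms, one
  for each order. So \<open>B\<close> enters the Clifford relations only through its symmetric part, which leaves
  the freedom to choose it triangular.
\<close>

lemma clifford_op_anticommute:
  "clifford_op B i (clifford_op B j f) + clifford_op B j (clifford_op B i f) = (B i j + B j i) *\<^sub>R f"
proof -
  let ?d = "\<lambda>i f. \<Sum>k\<in>UNIV. B i k *\<^sub>R annihilation k f"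
  have lin: "linear (?d i)" for i
    by (intro linear_compose_sum ballI linear_compose_scale_right linear_annihilation)
  have cd: "creation i (?d j f) + ?d j (creation i f) = B j i *\<^sub>R f" for i j f
  proof -
    have "creation i (?d j f) + ?d j (creation i f)
        = (\<Sum>k\<in>UNIV. B j k *\<^sub>R (creation i (annihilation k f) + annihilation k (creation i f)))"
      by (simp add: linear_sum[OF linear_creation] linear_cmul[OF linear_creation]
            scaleR_add_right sum.distrib)
    also have "\<dots> = (\<Sum>k\<in>UNIV. if i = k then B j k *\<^sub>R f else 0)"
      by (intro sum.cong) (simp_all only: creation_annihilation, auto)
    finally show ?thesis by simp
  qed
  have dd: "?d i (?d j f) + ?d j (?d i f) = 0"
  proof -
    have "?d i (?d j f) + ?d j (?d i f)
       = (\<Sum>k\<in>UNIV. \<Sum>l\<in>UNIV. (B i k * B j l) *\<^sub>R annihilation k (annihilation l f))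
         + (\<Sum>l\<in>UNIV. \<Sum>k\<in>UNIV. (B i k * B j l) *\<^sub>R annihilation l (annihilation k f))"
      by (simp add: linear_sum[OF linear_annihilation] linear_cmul[OF linear_annihilation]
            scaleR_sum_right mult.commute)
    also have "(\<Sum>l\<in>UNIV. \<Sum>k\<in>UNIV. (B i k * B j l) *\<^sub>R annihilation l (annihilation k f))
        = (\<Sum>k\<in>UNIV. \<Sum>l\<in>UNIV. (B i k * B j l) *\<^sub>R annihilation l (annihilation k f))"
      by (rule sum.swap)
    finally show ?thesis
      by (simp only: sum.distrib[symmetric] scaleR_add_right[symmetric] annihilation_annihilation) simp
  qed
  have "clifford_op B i (clifford_op B j f) + clifford_op B j (clifford_op B i f)
     = (creation i (creation j f) + creation j (creation i f))
       + (creation i (?d j f) + ?d j (creation i f)) + (creation j (?d i f) + ?d i (creation j f))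
       + (?d i (?d j f) + ?d j (?d i f))"
    unfolding clifford_op_def
    by (simp add: linear_add[OF linear_creation] linear_add[OF lin[of i]] linear_add[OF lin[of j]]
       del: sum.distrib)
  then show ?thesis
    unfolding creation_creation cd dd by (simp add: scaleR_add_left)
qed

definition word_action ::
    "('n \<Rightarrow> 'n \<Rightarrow> real) \<Rightarrow> 'n::{finite,linorder} word \<Rightarrow> real ^ 'n set \<Rightarrow> real ^ 'n set" where
  "word_action B w = foldr (clifford_op B) (letters w)"

definition free_action ::
    "('n \<Rightarrow> 'n \<Rightarrow> real) \<Rightarrow> 'n::{finite,linorder} free_algebra \<Rightarrow> real ^ 'n set \<Rightarrow> real ^ 'n set" where
  "free_action B p f = (\<Sum>w\<in>Poly_Mapping.keys p. Poly_Mapping.lookup p w *\<^sub>R word_action B w f)"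

lemma linear_word_action: "linear (word_action B w)"
proof -
  have "linear (foldr (clifford_op B) xs)" for xs
  proof (induction xs)
    case Nil
    then show ?case using linear_ident by (simp add: id_def)
  next
    case (Cons j xs)
    then show ?case using linear_compose[OF Cons linear_clifford_op] by (simp add: o_def)
  qed
  then show ?thesis by (simp add: word_action_def)
qed

lemma linear_free_action: "linear (free_action B p)"
  unfolding free_action_def
  by (intro linear_compose_sum ballI linear_compose_scale_right linear_word_action)

lemma free_action_superset:
  assumes "finite S" "Poly_Mapping.keys p \<subseteq> S"
  shows "free_action B p f = (\<Sum>w\<in>S. Poly_Mapping.lookup p w *\<^sub>R word_action B w f)"
  unfolding free_action_def using assms
  by (intro sum.mono_neutral_left) (auto simp: in_keys_iff)

lemma free_action_add: "free_action B (p + q) f = free_action B p f + free_action B q f"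
proof -
  let ?S = "Poly_Mapping.keys p \<union> Poly_Mapping.keys q"
  have "Poly_Mapping.keys (p + q) \<subseteq> ?S" by (rule Poly_Mapping.keys_add)
  then show ?thesis
    by (simp add: free_action_superset[of ?S] lookup_add scaleR_add_left sum.distrib)
qed

lemma free_action_single: "free_action B (Poly_Mapping.single w c) f = c *\<^sub>R word_action B w f"
  by (simp add: free_action_def)

lemma free_algebra_induct [case_names single add]:
  assumes "\<And>w c. P (Poly_Mapping.single w c)" "\<And>p q. P p \<Longrightarrow> P q \<Longrightarrow> P (p + q)"
  shows "P (p :: 'n free_algebra)"
proof (induction p rule: update_induct)
  case const
  then show ?case using assms(1)[of 0 0] by simp
next
  case (update f a b)
  have "Poly_Mapping.update a b f = f + Poly_Mapping.single a b"
    using update(1)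
    by (intro poly_mapping_eqI) (auto simp: lookup_update lookup_add lookup_single in_keys_iff when_def)
  then show ?case using assms update by simp
qed

text \<open>
  The evaluation of noncommutative polynomials at the operators is a representation of the free
  algebra; both sides are additive in \<open>p\<close> and \<open>q\<close>, which reduces the claim to concatenation of words.
\<close>

lemma free_action_mult: "free_action B (p * q) f = free_action B p (free_action B q f)"
proof (induction p rule: free_algebra_induct)
  case (single v a)
  show ?case
  proof (induction q rule: free_algebra_induct)
    case (single w b)
    have "word_action B (v + w) f = word_action B v (word_action B w f)"
      by (simp add: word_action_def plus_word_def)
    then show ?case
      by (simp add: mult_single free_action_single linear_cmul[OF linear_word_action])
  next
    case (add p q)
    then show ?case
      by (simp add: distrib_left free_action_add linear_add[OF linear_free_action])
  qed
next
  case (add p q)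
  then show ?case by (simp add: distrib_right free_action_add)
qed

lemma free_action_minus: "free_action B (p - q) f = free_action B p f - free_action B q f"
  using free_action_add[of B "p - q" q f] by simp

lemma free_action_zero: "free_action B 0 f = 0"
  by (simp add: free_action_def)

lemma free_action_sum: "free_action B (sum g S) f = (\<Sum>x\<in>S. free_action B (g x) f)"
  by (induction S rule: infinite_finite_induct) (simp_all add: free_action_zero free_action_add)

lemma free_action_var: "free_action B (free_var j) f = clifford_op B j f"
  by (simp add: free_var_def free_action_single word_action_def)

lemma free_action_const: "free_action B (free_const r) f = r *\<^sub>R f"
  by (simp add: free_const_def free_action_single word_action_def zero_word_def)

lemma ring_free_algebra: "ring (ring_of_type_algebra :: 'a::ring_1 ring)"
proof -
  have "\<exists>y. x + y = 0" for x :: 'a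
    by (rule exI[of _ "- x"]) simp
  moreover have "\<exists>y. y + x = 0" for x :: 'a
    by (rule exI[of _ "- x"]) simp
  ultimately show ?thesis
    unfolding ring_of_type_algebra_def
    by unfold_locales (auto simp: algebra_simps Units_def add_eq_0_iff2)
qed

lemma ideal_clifford: "ideal (clifford_ideal \<alpha> \<gamma>) ring_of_type_algebra"
  unfolding clifford_ideal_def
  by (rule ring.genideal_ideal[OF ring_free_algebra]) (simp add: ring_of_type_algebra_def)

text \<open>
  The polynomials that act as zero form the kernel of the representation. Since the Clifford ideal
  is generated by its relators, it will suffice to check that these act as zero.
\<close>

lemma ideal_annihilator:
  "ideal {p. \<forall>f. free_action B p f = 0} (ring_of_type_algebra :: 'n::{finite,linorder} free_algebra ring)"
proof (rule idealI)
  let ?R = "ring_of_type_algebra :: 'n free_algebra ring"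
  let ?J = "{p. \<forall>f. free_action B p f = 0}"
  interpret R: ring ?R by (rule ring_free_algebra)
  show "ring ?R" by (rule ring_free_algebra)
  show "subgroup ?J (add_monoid ?R)"
  proof (rule group.subgroupI[OF R.a_group])
    show "inv\<^bsub>add_monoid ?R\<^esub> p \<in> ?J" if "p \<in> ?J" for p
    proof -
      have "p + (inv\<^bsub>add_monoid ?R\<^esub> p) = 0"
        using R.r_neg[of p] by (simp add: a_inv_def ring_of_type_algebra_def)
      then have "inv\<^bsub>add_monoid ?R\<^esub> p = 0 - p" by (simp add: eq_neg_iff_add_eq_0 add.commute)
      then show ?thesis using that by (simp add: free_action_minus free_action_zero del: diff_0)
    qed
  qed (auto simp: ring_of_type_algebra_def free_action_zero free_action_add intro: exI[of _ 0])
qed (auto simp: ring_of_type_algebra_def free_action_mult linear_0[OF linear_free_action])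

text \<open>
  The representation of the free algebra descends to the Clifford algebra, because the symmetrization
  of \<open>B\<close> carries the prescribed parameters. The form vanishes above the diagonal, so that the contraction
  part of a generator does not act on later generators.
\<close>

lemma free_action_clifford_ideal:
  fixes \<alpha> :: "'n::{finite,linorder} \<Rightarrow> real"
  assumes "\<And>i j. i \<noteq> j \<Longrightarrow> \<gamma> i j = \<gamma> j i"
  defines "B \<equiv> \<lambda>i j. if i = j then - \<alpha> i else if j < i then 2 * \<gamma> i j else 0"
  assumes "p \<in> clifford_ideal \<alpha> \<gamma>"
  shows "free_action B p f = 0"
proof -
  have "clifford_relators \<alpha> \<gamma> \<subseteq> {p. \<forall>f. free_action B p f = 0}"
  proof
    fix p :: "'n free_algebra"
    assume "p \<in> clifford_relators \<alpha> \<gamma>"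
    then consider (sq) j where "p = free_var j * free_var j + free_const (\<alpha> j)"
      | (mix) i j where "i \<noteq> j"
          "p = free_var i * free_var j + free_var j * free_var i - free_const (2 * \<gamma> i j)"
      unfolding clifford_relators_def by blast
    then show "p \<in> {p. \<forall>f. free_action B p f = 0}"
    proof cases
      case sq
      have "2 *\<^sub>R clifford_op B j (clifford_op B j f) = 2 *\<^sub>R (- \<alpha> j *\<^sub>R f)" for f
        using clifford_op_anticommute[of B j j f]
        by (simp add: B_def scaleR_2 scaleR_add_left)
      then have "clifford_op B j (clifford_op B j f) = - \<alpha> j *\<^sub>R f" for f
        by (metis scaleR_left_imp_eq zero_neq_numeral)
      then show ?thesis
        by (simp add: sq free_action_add free_action_mult free_action_var free_action_const)
    next
      case mix
      then have "B i j + B j i = 2 * \<gamma> i j"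
        using assms(1)[of i j] by (auto simp: B_def)
      then show ?thesis
        by (simp add: mix free_action_add free_action_minus free_action_mult free_action_var
            free_action_const clifford_op_anticommute)
    qed
  qed
  then have "clifford_ideal \<alpha> \<gamma> \<subseteq> {p. \<forall>f. free_action B p f = 0}"
    unfolding clifford_ideal_def
    by (intro ring.genideal_minimal[OF ring_free_algebra] ideal_annihilator)
  then show ?thesis using assms(3) by blast
qed

text \<open>
  When \<open>j\<close> precedes all members of \<open>A\<close>, the wedge factor goes to the front without a sign, and the
  contraction only sees values \<open>B j k\<close> with \<open>j < k\<close>, which vanish.
\<close>

lemma clifford_op_axis:
  assumes "\<And>k. j < k \<Longrightarrow> B j k = 0" "\<And>k. k \<in> A \<Longrightarrow> j < k"
  shows "clifford_op B j (axis A 1) = axis (insert j A) 1"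
proof -
  have "creation j (axis A 1) = axis (insert j A) 1"
  proof -
    have "crossing_sign j (insert j A) = 1"
    proof -
      have "{l \<in> insert j A. l < j} = {}" using assms(2) by force
      then show ?thesis by (simp only: crossing_sign_def card.empty power_0)
    qed
    moreover have "j \<notin> A" using assms(2) by blast
    ultimately show ?thesis
      by (auto simp: creation_def vec_eq_iff axis_def insert_absorb)
  qed
  moreover have "B j k *\<^sub>R annihilation k (axis A 1) = 0" for k
  proof (cases "k \<in> A")
    case True
    then show ?thesis using assms by simp
  next
    case False
    then have "annihilation k (axis A 1) = 0"
      by (auto simp: annihilation_def vec_eq_iff axis_def)
    then show ?thesis by simp
  qed
  ultimately show ?thesis
    unfolding clifford_op_def by (simp only: sum.neutral_const add_0_right)
qed

text \<open>
  Hence, for a triangular form, the product of the generators of \<open>A\<close> in increasing order sends the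
  vacuum to the basis vector \<open>A\<close> itself, without lower-order terms.
\<close>

lemma word_action_axis:
  assumes "\<And>j k. j < k \<Longrightarrow> B j k = 0"
  shows "word_action B (Word (sorted_list_of_set A)) (axis {} 1) = axis A 1"
proof -
  have "foldr (clifford_op B) xs (axis {} 1) = axis (set xs) 1" if "sorted_wrt (<) xs" for xs
    using that by (induction xs) (auto simp: clifford_op_axis assms)
  then show ?thesis by (simp add: word_action_def)
qed

section \<open>Coordinates in the Clifford algebra\<close>

lemma free_const_mult: "free_const r * free_const s = (free_const (r * s) :: 'n free_algebra)"
  by (simp add: free_const_def mult_single)

lemma free_const_commute: "p * free_const r = free_const r * (p :: 'n free_algebra)"
proof (induction p rule: free_algebra_induct)
  case (single w c)
  then show ?case by (simp add: free_const_def mult_single mult.commute)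
next
  case (add p q)
  then show ?case by (simp add: distrib_left distrib_right)
qed

lemma free_const_add: "free_const (r + s) = (free_const r + free_const s :: 'n free_algebra)"
  by (simp add: free_const_def single_add)

lemma free_const_zero: "free_const 0 = (0 :: 'n free_algebra)"
  by (simp add: free_const_def)

lemma free_const_sum: "free_const (sum c S) = (\<Sum>i\<in>S. free_const (c i) :: 'n free_algebra)"
  by (induction S rule: infinite_finite_induct) (simp_all add: free_const_zero free_const_add)

lemma ring_hom_clifford_class:
  "ring_hom_ring ring_of_type_algebra (clifford_algebra \<alpha> \<gamma>) (clifford_class \<alpha> \<gamma>)"
  using ideal.rcos_ring_hom_ring[OF ideal_clifford[of \<alpha> \<gamma>]]
  by (simp add: clifford_algebra_def clifford_class_def[abs_def])

lemma
  shows clifford_class_closed: "clifford_class \<alpha> \<gamma> p \<in> carrier (clifford_algebra \<alpha> \<gamma>)"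
    and clifford_class_add: "clifford_class \<alpha> \<gamma> (p + q) =
      clifford_class \<alpha> \<gamma> p \<oplus>\<^bsub>clifford_algebra \<alpha> \<gamma>\<^esub> clifford_class \<alpha> \<gamma> q"
    and clifford_class_mult: "clifford_class \<alpha> \<gamma> (p * q) =
      clifford_class \<alpha> \<gamma> p \<otimes>\<^bsub>clifford_algebra \<alpha> \<gamma>\<^esub> clifford_class \<alpha> \<gamma> q"
    and clifford_class_zero: "clifford_class \<alpha> \<gamma> 0 = \<zero>\<^bsub>clifford_algebra \<alpha> \<gamma>\<^esub>"
    and clifford_class_one: "clifford_class \<alpha> \<gamma> 1 = \<one>\<^bsub>clifford_algebra \<alpha> \<gamma>\<^esub>"
proof -
  interpret ring_hom_ring ring_of_type_algebra "clifford_algebra \<alpha> \<gamma>" "clifford_class \<alpha> \<gamma>"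
    by (rule ring_hom_clifford_class)
  show "clifford_class \<alpha> \<gamma> p \<in> carrier (clifford_algebra \<alpha> \<gamma>)"
    using hom_closed[of p] by (simp add: ring_of_type_algebra_def)
  show "clifford_class \<alpha> \<gamma> (p + q) =
      clifford_class \<alpha> \<gamma> p \<oplus>\<^bsub>clifford_algebra \<alpha> \<gamma>\<^esub> clifford_class \<alpha> \<gamma> q"
    using hom_add[of p q] by (simp add: ring_of_type_algebra_def)
  show "clifford_class \<alpha> \<gamma> (p * q) =
      clifford_class \<alpha> \<gamma> p \<otimes>\<^bsub>clifford_algebra \<alpha> \<gamma>\<^esub> clifford_class \<alpha> \<gamma> q"
    using hom_mult[of p q] by (simp add: ring_of_type_algebra_def)
  show "clifford_class \<alpha> \<gamma> 0 = \<zero>\<^bsub>clifford_algebra \<alpha> \<gamma>\<^esub>"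
    using hom_zero by (simp add: ring_of_type_algebra_def)
  show "clifford_class \<alpha> \<gamma> 1 = \<one>\<^bsub>clifford_algebra \<alpha> \<gamma>\<^esub>"
    using hom_one by (simp add: ring_of_type_algebra_def)
qed

lemma clifford_class_sum:
  assumes "finite S"
  shows "clifford_class \<alpha> \<gamma> (\<Sum>i\<in>S. p i) =
    (\<Oplus>\<^bsub>clifford_algebra \<alpha> \<gamma>\<^esub> i\<in>S. clifford_class \<alpha> \<gamma> (p i))"
proof -
  interpret Q: ring "clifford_algebra \<alpha> \<gamma>"
    unfolding clifford_algebra_def by (rule ideal.quotient_is_ring[OF ideal_clifford])
  show ?thesis
    using assms
    by (induction S) (auto simp: clifford_class_zero clifford_class_add clifford_class_closed)
qed

lemma
  shows clifford_ideal_diff: "p \<in> clifford_ideal \<alpha> \<gamma> \<Longrightarrow> q \<in> clifford_ideal \<alpha> \<gamma> \<Longrightarrow> p - q \<in> clifford_ideal \<alpha> \<gamma>"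
    and clifford_ideal_mult_left: "p \<in> clifford_ideal \<alpha> \<gamma> \<Longrightarrow> r * p \<in> clifford_ideal \<alpha> \<gamma>"
    and clifford_ideal_add: "p \<in> clifford_ideal \<alpha> \<gamma> \<Longrightarrow> q \<in> clifford_ideal \<alpha> \<gamma> \<Longrightarrow> p + q \<in> clifford_ideal \<alpha> \<gamma>"
    and clifford_ideal_zero: "0 \<in> clifford_ideal \<alpha> \<gamma>"
proof -
  interpret ideal "clifford_ideal \<alpha> \<gamma>" ring_of_type_algebra by (rule ideal_clifford)
  show l: "r * p \<in> clifford_ideal \<alpha> \<gamma>" if "p \<in> clifford_ideal \<alpha> \<gamma>" for p r
    using I_l_closed[OF that, of r] by (simp add: ring_of_type_algebra_def)
  show a: "p + q \<in> clifford_ideal \<alpha> \<gamma>" if "p \<in> clifford_ideal \<alpha> \<gamma>" "q \<in> clifford_ideal \<alpha> \<gamma>" for p q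
    using additive_subgroup.a_closed[OF is_additive_subgroup that] by (simp add: ring_of_type_algebra_def)
  show "p - q \<in> clifford_ideal \<alpha> \<gamma>" if "p \<in> clifford_ideal \<alpha> \<gamma>" "q \<in> clifford_ideal \<alpha> \<gamma>"
    using a[OF that(1) l[OF that(2), of "- 1"]] by simp
  show "0 \<in> clifford_ideal \<alpha> \<gamma>"
    using additive_subgroup.zero_closed[OF is_additive_subgroup]
    by (simp add: ring_of_type_algebra_def)
qed

text \<open>
  Equalities in the Clifford algebra become membership statements about explicit elements of the free
  algebra; in this form the representation can be applied to them.
\<close>

lemma clifford_class_eq_iff:
  "clifford_class \<alpha> \<gamma> p = clifford_class \<alpha> \<gamma> q \<longleftrightarrow> p - q \<in> clifford_ideal \<alpha> \<gamma>"
proof -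
  have coset: "clifford_class \<alpha> \<gamma> p = {h + p | h. h \<in> clifford_ideal \<alpha> \<gamma>}" for p
    by (auto simp: clifford_class_def a_r_coset_def' ring_of_type_algebra_def)
  show ?thesis
  proof
    assume "clifford_class \<alpha> \<gamma> p = clifford_class \<alpha> \<gamma> q"
    moreover have "p \<in> clifford_class \<alpha> \<gamma> p"
      using clifford_ideal_zero[of \<alpha> \<gamma>] by (force simp: coset)
    ultimately show "p - q \<in> clifford_ideal \<alpha> \<gamma>" by (auto simp: coset)
  next
    assume pq: "p - q \<in> clifford_ideal \<alpha> \<gamma>"
    have "h + p = (h + (p - q)) + q" "h + q = (h - (p - q)) + p" for h by simp_all
    with pq show "clifford_class \<alpha> \<gamma> p = clifford_class \<alpha> \<gamma> q"
      unfolding coset by (blast intro: clifford_ideal_add clifford_ideal_diff)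
  qed
qed

text \<open>
  Representatives in the free algebra of the generators (with \<open>e\<^sub>0 = 1\<close>) and of the basis elements
  \<open>e\<^sub>A\<close>.
\<close>

fun free_gen :: "'n option \<Rightarrow> 'n free_algebra" where
  "free_gen None = 1"
| "free_gen (Some j) = free_var j"

definition free_basis :: "'n::linorder set \<Rightarrow> 'n free_algebra" where
  "free_basis A = Poly_Mapping.single (Word (sorted_list_of_set A)) 1"

lemma clifford_gen_class: "clifford_gen \<alpha> \<gamma> j = clifford_class \<alpha> \<gamma> (free_gen j)"
  by (cases j) (simp_all add: clifford_class_one)

lemma clifford_basis_class: "clifford_basis \<alpha> \<gamma> A = clifford_class \<alpha> \<gamma> (free_basis A)"
proof -
  have "foldr (\<lambda>j v. clifford_gen \<alpha> \<gamma> (Some j) \<otimes>\<^bsub>clifford_algebra \<alpha> \<gamma>\<^esub> v) js \<one>\<^bsub>clifford_algebra \<alpha> \<gamma>\<^esub>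
      = clifford_class \<alpha> \<gamma> (Poly_Mapping.single (Word js) 1)" for js
  proof (induction js)
    case Nil
    have "Poly_Mapping.single (Word []) 1 = (1 :: 'a free_algebra)"
      by (simp flip: zero_word_def)
    then show ?case by (simp add: clifford_class_one)
  next
    case (Cons j js)
    have "Poly_Mapping.single (Word (j # js)) 1
        = free_var j * (Poly_Mapping.single (Word js) 1 :: 'a free_algebra)"
      by (simp add: free_var_def mult_single plus_word_def)
    then show ?case using Cons by (simp add: clifford_class_mult)
  qed
  then show ?thesis by (simp add: clifford_basis_def free_basis_def)
qed

lemma clifford_scale_class:
  "clifford_scale \<alpha> \<gamma> r (clifford_class \<alpha> \<gamma> p) = clifford_class \<alpha> \<gamma> (free_const r * p)"
  by (simp add: clifford_scale_def clifford_class_mult)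

lemma clifford_comb_class:
  "clifford_comb \<alpha> \<gamma> c = clifford_class \<alpha> \<gamma> (\<Sum>A\<in>UNIV. free_const (c A) * free_basis A)"
  by (simp add: clifford_comb_def clifford_basis_class clifford_scale_class clifford_class_sum)

text \<open>
  Linear independence of the \<open>e\<^sub>A\<close>: applied to the vacuum, a linear combination of them returns the
  vector of its coefficients.
\<close>

lemma clifford_coord_comb:
  fixes \<alpha> :: "'n::{finite,linorder} \<Rightarrow> real"
  assumes "\<And>i j. i \<noteq> j \<Longrightarrow> \<gamma> i j = \<gamma> j i"
  shows "clifford_coord \<alpha> \<gamma> (clifford_comb \<alpha> \<gamma> c) = c"
proof -
  define B where "B = (\<lambda>i j. if i = j then - \<alpha> i else if j < i then 2 * \<gamma> i j else 0)"
  \<comment> \<open>The vacuum vector \<open>axis {} 1\<close> separates the combinations.\<close>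
  have vac: "free_action B (\<Sum>A\<in>UNIV. free_const (c A) * free_basis A) (axis {} 1) = vec_lambda c" for c
  proof -
    have "word_action B (Word (sorted_list_of_set A)) (axis {} 1) = axis A 1" for A
      by (rule word_action_axis) (auto simp: B_def)
    then have "free_action B (\<Sum>A\<in>UNIV. free_const (c A) * free_basis A) (axis {} 1)
        = (\<Sum>A\<in>UNIV. c A *\<^sub>R axis A 1)"
      by (simp add: free_action_sum free_action_mult free_action_const free_basis_def
          free_action_single)
    also have "\<dots> = vec_lambda c"
      using basis_expansion[of "vec_lambda c"] by (simp add: scalar_mult_eq_scaleR)
    finally show ?thesis .
  qed
  have "c' = c" if "clifford_comb \<alpha> \<gamma> c = clifford_comb \<alpha> \<gamma> c'" for c'
  proof -
    have "free_action B ((\<Sum>A\<in>UNIV. free_const (c A) * free_basis A)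
        - (\<Sum>A\<in>UNIV. free_const (c' A) * free_basis A)) (axis {} 1) = 0"
      unfolding B_def
      by (rule free_action_clifford_ideal[where \<gamma> = \<gamma>])
        (use assms that in \<open>auto simp: clifford_comb_class clifford_class_eq_iff\<close>)
    then have "vec_lambda c = vec_lambda c'"
      by (simp add: free_action_minus vac)
    then show ?thesis by (metis vec_lambda_inverse UNIV_I)
  qed
  then show ?thesis unfolding clifford_coord_def by (intro the_equality) auto
qed

section \<open>The operators in coordinates\<close>

text \<open>
  The linear relations between the products \<open>e\<^sub>j e\<^sub>A\<close>. There are more such products than the dimension of
  the algebra, so these relations are not trivial; it is enough for the proof that they form a subspace.
\<close>

definition gradient_relations ::
    "('n::{finite,linorder} \<Rightarrow> real) \<Rightarrow> ('n \<Rightarrow> 'n \<Rightarrow> real) \<Rightarrow> (real ^ ('n option \<times> 'n set)) set" where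
  "gradient_relations \<alpha> \<gamma> =
     {c. (\<Sum>p\<in>UNIV. free_const (c $ p) * (free_gen (fst p) * free_basis (snd p))) \<in> clifford_ideal \<alpha> \<gamma>}"

lemma subspace_gradient_relations: "subspace (gradient_relations \<alpha> \<gamma>)"
proof (rule subspaceI)
  show "0 \<in> gradient_relations \<alpha> \<gamma>"
    by (simp add: gradient_relations_def free_const_zero clifford_ideal_zero)
  show "c + d \<in> gradient_relations \<alpha> \<gamma>"
    if "c \<in> gradient_relations \<alpha> \<gamma>" "d \<in> gradient_relations \<alpha> \<gamma>" for c d
    using clifford_ideal_add[of _ \<alpha> \<gamma>] that
    by (simp add: gradient_relations_def free_const_add distrib_right sum.distrib)
  show "r *\<^sub>R c \<in> gradient_relations \<alpha> \<gamma>" if "c \<in> gradient_relations \<alpha> \<gamma>" for r c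
    using clifford_ideal_mult_left[of "\<Sum>p\<in>UNIV. free_const (c $ p) * (free_gen (fst p) * free_basis (snd p))"
        \<alpha> \<gamma> "free_const r"] that
    by (simp add: gradient_relations_def sum_distrib_left mult.assoc flip: free_const_mult)
qed

text \<open>
  Scalars are central, so the weights and the partial derivatives of the coordinates can be collected in
  front of the products \<open>e\<^sub>j e\<^sub>A\<close>. This turns the equation \<open>\<D> u = 0\<close> into membership in a subspace that is the
  same at all points, which is what allows it to be differentiated.
\<close>

lemma cauchy_riemann_op_eq_zero_iff:
  "cauchy_riemann_op \<alpha> \<gamma> lam u x = \<zero>\<^bsub>clifford_algebra \<alpha> \<gamma>\<^esub> \<longleftrightarrow>
     (\<chi> p. lam (fst p) x * partial (fst p) (\<lambda>y. clifford_coord \<alpha> \<gamma> (u y) (snd p)) x)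
       \<in> gradient_relations \<alpha> \<gamma>"
proof -
  let ?d = "\<lambda>j A. partial j (\<lambda>y. clifford_coord \<alpha> \<gamma> (u y) A) x"
  have "cauchy_riemann_op \<alpha> \<gamma> lam u x = clifford_class \<alpha> \<gamma>
      (\<Sum>j\<in>UNIV. free_const (lam j x) * (free_gen j * (\<Sum>A\<in>UNIV. free_const (?d j A) * free_basis A)))"
    unfolding cauchy_riemann_op_def clifford_partial_def clifford_comb_class clifford_gen_class
      clifford_class_mult[symmetric] clifford_scale_class
    by (simp add: clifford_class_sum)
  also have "(\<Sum>j\<in>UNIV. free_const (lam j x) * (free_gen j * (\<Sum>A\<in>UNIV. free_const (?d j A) * free_basis A)))
      = (\<Sum>j\<in>UNIV. \<Sum>A\<in>UNIV. free_const (lam j x * ?d j A) * (free_gen j * free_basis A))"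
  proof -
    have "free_gen j * (free_const r * q) = free_const r * (free_gen j * q)" for j r and q :: "'a free_algebra"
      by (metis free_const_commute mult.assoc)
    then show ?thesis
      by (simp add: sum_distrib_left free_const_mult mult.assoc flip: free_const_mult)
  qed
  also have "\<dots> = (\<Sum>p\<in>UNIV. free_const (lam (fst p) x * ?d (fst p) (snd p)) * (free_gen (fst p) * free_basis (snd p)))"
    by (simp add: sum.cartesian_product UNIV_Times_UNIV case_prod_beta)
  finally show ?thesis
    by (simp add: clifford_class_eq_iff gradient_relations_def flip: clifford_class_zero)
qed

text \<open>
  The coefficients \<open>a i\<close> are scalars, so the operator acts on each coordinate separately. The
  coordinates can be read off because the \<open>e\<^sub>A\<close> are independent.
\<close>

lemma clifford_coord_first_order_op:
  fixes \<alpha> :: "'n::{finite,linorder} \<Rightarrow> real"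
  assumes "\<And>i j. i \<noteq> j \<Longrightarrow> \<gamma> i j = \<gamma> j i"
  shows "clifford_coord \<alpha> \<gamma> (first_order_op \<alpha> \<gamma> a u x) A =
    (\<Sum>i\<in>UNIV. a i x * partial i (\<lambda>y. clifford_coord \<alpha> \<gamma> (u y) A) x)"
proof -
  let ?d = "\<lambda>j A. partial j (\<lambda>y. clifford_coord \<alpha> \<gamma> (u y) A) x"
  have "(\<Sum>i\<in>UNIV. free_const (a i x) * (\<Sum>A\<in>UNIV. free_const (?d i A) * free_basis A))
      = (\<Sum>i\<in>UNIV. \<Sum>A\<in>UNIV. free_const (a i x * ?d i A) * free_basis A)"
    by (simp add: sum_distrib_left mult.assoc flip: free_const_mult)
  also have "\<dots> = (\<Sum>A\<in>UNIV. \<Sum>i\<in>UNIV. free_const (a i x * ?d i A) * free_basis A)"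
    by (rule sum.swap)
  also have "\<dots> = (\<Sum>A\<in>UNIV. free_const (\<Sum>i\<in>UNIV. a i x * ?d i A) * free_basis A)"
    by (simp add: sum_distrib_right free_const_sum)
  finally have "first_order_op \<alpha> \<gamma> a u x = clifford_comb \<alpha> \<gamma> (\<lambda>A. \<Sum>i\<in>UNIV. a i x * ?d i A)"
    unfolding first_order_op_def clifford_partial_def clifford_comb_class
    by (simp add: clifford_scale_class flip: clifford_class_sum)
  then show ?thesis by (simp add: clifford_coord_comb assms)
qed

section \<open>Associated operators\<close>

theorem theorem2:
  fixes \<alpha> :: "'n::{finite,linorder} \<Rightarrow> real"
    and \<gamma> :: "'n \<Rightarrow> 'n \<Rightarrow> real"
    and \<Omega> :: "(real ^ 'n option) set"
    and a :: "'n option \<Rightarrow> real ^ 'n option \<Rightarrow> real"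
    and lam :: "'n option \<Rightarrow> real ^ 'n option \<Rightarrow> real"
    and \<beta> :: "'n \<Rightarrow> real ^ 'n option \<Rightarrow> real"
  assumes "\<And>i j. i \<noteq> j \<Longrightarrow> \<gamma> i j = \<gamma> j i"
    and "open \<Omega>" and "connected \<Omega>" and "\<Omega> \<noteq> {}"
    and "\<And>i. class_C 1 \<Omega> (a i)"
    and "\<And>i x y. x \<in> \<Omega> \<Longrightarrow> y \<in> \<Omega> \<Longrightarrow> x $ i = y $ i \<Longrightarrow> a i x = a i y"
    and "\<And>j. class_C 1 \<Omega> (lam j)"
    and "\<And>x. x \<in> \<Omega> \<Longrightarrow> lam None x \<noteq> 0"
    and "\<And>i. \<beta> i = (\<lambda>x. lam (Some i) x / lam None x)"
    and "\<And>i x. x \<in> \<Omega> \<Longrightarrow>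
           \<beta> i x * (partial (Some i) (a (Some i)) x - partial None (a None) x)
             - (\<Sum>j\<in>UNIV. a j x * partial j (\<beta> i) x) = 0"
  shows "associated_operators \<alpha> \<gamma> \<Omega> (first_order_op \<alpha> \<gamma> a) (cauchy_riemann_op \<alpha> \<gamma> lam)"
  unfolding associated_operators_def
proof (intro allI impI ballI)
  fix u :: "real ^ 'n option \<Rightarrow> 'n free_algebra set" and x
  assume "clifford_class_C \<alpha> \<gamma> 2 \<Omega> u" and Du: "\<forall>x\<in>\<Omega>. cauchy_riemann_op \<alpha> \<gamma> lam u x = \<zero>\<^bsub>clifford_algebra \<alpha> \<gamma>\<^esub>"
    and x: "x \<in> \<Omega>"
  define U where "U = (\<lambda>A y. clifford_coord \<alpha> \<gamma> (u y) A)"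
  define b where "b = (\<lambda>j y. lam j y / lam None y)"
  define K where "K = gradient_relations \<alpha> \<gamma>"
  have K: "subspace K" unfolding K_def by (rule subspace_gradient_relations)
  have U2: "class_C 2 \<Omega> (U A)" for A
    using \<open>clifford_class_C \<alpha> \<gamma> 2 \<Omega> u\<close> by (simp add: clifford_class_C_def U_def)
  then have U1: "class_C (Suc 0) \<Omega> (partial j (U A))" for A j
    by (simp add: numeral_2_eq_2)
  have a1: "class_C (Suc 0) \<Omega> (a i)" for i
    using assms(5) by simp

  \<comment> \<open>Normalization by \<open>\<lambda>\<^sub>0\<close>: \<open>W\<close> lists the terms of \<open>\<partial>\<^sub>0 u + (\<Sum>i. \<beta>\<^sub>i e\<^sub>i \<partial>\<^sub>i u)\<close>.\<close>
  define W where "W = (\<lambda>y. \<chi> p. b (fst p) y * partial (fst p) (U (snd p)) y)"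
  have W: "W y \<in> K" if "y \<in> \<Omega>" for y
  proof -
    have "(\<chi> p. lam (fst p) y * partial (fst p) (U (snd p)) y) \<in> K"
      using Du that by (simp add: cauchy_riemann_op_eq_zero_iff K_def U_def)
    then have "(1 / lam None y) *\<^sub>R (\<chi> p. lam (fst p) y * partial (fst p) (U (snd p)) y) \<in> K"
      by (rule subspace_scale[OF K])
    also have "(1 / lam None y) *\<^sub>R (\<chi> p. lam (fst p) y * partial (fst p) (U (snd p)) y) = W y"
      by (simp add: W_def b_def vec_eq_iff)
    finally show ?thesis .
  qed
  \<comment> \<open>\<open>dW i\<close> is the derivative of \<open>W\<close> in direction \<open>i\<close> by the product rule.\<close>
  define dW where "dW = (\<lambda>i. \<chi> p. partial i (b (fst p)) x * partial (fst p) (U (snd p)) x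
      + b (fst p) x * partial i (partial (fst p) (U (snd p))) x)"
  have dW: "dW i \<in> K" for i
  proof (rule derivative_in_subspace[OF K])
    show "\<forall>\<^sub>F s in nhds 0. W (x + s *\<^sub>R axis i 1) \<in> K"
      using open_line_eventually[OF assms(2) x] by eventually_elim (rule W)
    fix p :: "'n option \<times> 'n set"
    have "((\<lambda>s. b (fst p) (x + s *\<^sub>R axis i 1)) has_real_derivative partial i (b (fst p)) x) (at 0)"
      unfolding b_def by (intro has_partial_divide[OF assms(7) assms(7)] x assms(8))
    from DERIV_mult[OF this class_C_has_partial[OF U1[of "fst p" "snd p"] x, of i]]
    show "((\<lambda>s. W (x + s *\<^sub>R axis i 1) $ p) has_real_derivative dW i $ p) (at 0)"
      by (simp add: W_def dW_def algebra_simps)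
  qed

  \<comment> \<open>The hypothesis on the \<open>\<beta>\<^sub>i\<close>, extended to the index \<open>0\<close>, where \<open>\<beta>\<^sub>0 = 1\<close> makes it trivial.\<close>
  have coeff: "b j x * partial j (a j) x
      = (\<Sum>i\<in>UNIV. a i x * partial i (b j) x) + partial None (a None) x * b j x" for j
  proof (cases j)
    case None
    have "partial i (b None) x = 0" for i
    proof (rule partial_eqI)
      have "\<forall>\<^sub>F t in nhds 0. b None (x + t *\<^sub>R axis i 1) = 1"
        using open_line_eventually[OF assms(2) x, of "axis i 1"]
        by eventually_elim (simp add: b_def assms(8))
      then show "((\<lambda>t. b None (x + t *\<^sub>R axis i 1)) has_real_derivative 0) (at 0)"
        using DERIV_cong_ev[of 0 0 "\<lambda>t. b None (x + t *\<^sub>R axis i 1)" "\<lambda>t. 1" 0 0] by simp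
    qed
    then show ?thesis using None by simp
  next
    case (Some k)
    have "b j = \<beta> k" using Some assms(9)[of k] by (simp add: b_def)
    then show ?thesis using assms(10)[OF x, of k] Some by (simp add: algebra_simps)
  qed

  have coord: "(\<lambda>y. clifford_coord \<alpha> \<gamma> (first_order_op \<alpha> \<gamma> a u y) A)
      = (\<lambda>y. \<Sum>i\<in>UNIV. a i y * partial i (U A) y)" for A
    using assms(1) by (simp add: clifford_coord_first_order_op U_def)
  \<comment> \<open>Each \<open>a i\<close> depends on one variable only, so a single first-order term survives. The mixed
    derivatives are put in the order in which they occur in \<open>dW\<close>.\<close>
  have dF: "partial j (\<lambda>y. \<Sum>i\<in>UNIV. a i y * partial i (U A) y) x
      = partial j (a j) x * partial j (U A) x + (\<Sum>i\<in>UNIV. a i x * partial i (partial j (U A)) x)" for j A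
  proof -
    have "partial j (\<lambda>y. \<Sum>i\<in>UNIV. a i y * partial i (U A) y) x
        = (\<Sum>i\<in>UNIV. partial j (a i) x * partial i (U A) x + a i x * partial j (partial i (U A)) x)"
    proof (intro partial_eqI DERIV_sum)
      fix i
      from DERIV_mult[OF class_C_has_partial[OF a1[of i] x, of j] class_C_has_partial[OF U1[of i A] x, of j]]
      show "((\<lambda>t. a i (x + t *\<^sub>R axis j 1) * partial i (U A) (x + t *\<^sub>R axis j 1)) has_real_derivative
          partial j (a i) x * partial i (U A) x + a i x * partial j (partial i (U A)) x) (at 0)"
        by (simp add: algebra_simps)
    qed
    also have "\<dots> = (\<Sum>i\<in>UNIV. (if i = j then partial j (a j) x * partial j (U A) x else 0)
          + a i x * partial i (partial j (U A)) x)"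
    proof (rule sum.cong)
      fix i
      show "partial j (a i) x * partial i (U A) x + a i x * partial j (partial i (U A)) x
        = (if i = j then partial j (a j) x * partial j (U A) x else 0) + a i x * partial i (partial j (U A)) x"
      proof (cases "i = j")
        case False
        then have "partial j (a i) x = 0"
          by (rule partial_eq_0_of_other_variable[OF assms(2) x]) (rule assms(6))
        with False show ?thesis by (simp add: partial_commute[OF assms(2) U2 x, of j i])
      qed simp
    qed simp
    finally show ?thesis by (simp add: sum.distrib)
  qed

  \<comment> \<open>By \<open>coeff\<close>, the first-order terms not accounted for by the \<open>dW i\<close> all carry the common factor
    \<open>\<partial>\<^sub>0 a\<^sub>0\<close>, so together they are a multiple of \<open>W\<close>.\<close>
  have "(\<chi> p. lam (fst p) x * partial (fst p) (\<lambda>y. clifford_coord \<alpha> \<gamma> (first_order_op \<alpha> \<gamma> a u y) (snd p)) x)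
      = lam None x *\<^sub>R ((\<Sum>i\<in>UNIV. a i x *\<^sub>R dW i) + partial None (a None) x *\<^sub>R W x)"
  proof (subst vec_eq_iff, intro allI)
    fix p :: "'n option \<times> 'n set"
    obtain j A where p: "p = (j, A)" by (cases p)
    have lam: "lam j x = lam None x * b j x"
      using assms(8)[OF x] by (simp add: b_def)
    have "b j x * (partial j (a j) x * partial j (U A) x + (\<Sum>i\<in>UNIV. a i x * partial i (partial j (U A)) x))
      = (b j x * partial j (a j) x) * partial j (U A) x
        + (\<Sum>i\<in>UNIV. a i x * (b j x * partial i (partial j (U A)) x))"
      by (simp add: distrib_left sum_distrib_left mult.assoc mult.left_commute)
    also have "\<dots> = (\<Sum>i\<in>UNIV. a i x * dW i $ p) + partial None (a None) x * W x $ p"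
    proof -
      have "(\<Sum>i\<in>UNIV. a i x * dW i $ p) = (\<Sum>i\<in>UNIV. a i x * partial i (b j) x) * partial j (U A) x
          + (\<Sum>i\<in>UNIV. a i x * (b j x * partial i (partial j (U A)) x))"
        by (simp add: p dW_def distrib_left sum.distrib sum_distrib_right mult.assoc)
      then show ?thesis
        unfolding coeff by (simp add: p W_def distrib_right mult.assoc)
    qed
    finally show "(\<chi> p. lam (fst p) x * partial (fst p) (\<lambda>y. clifford_coord \<alpha> \<gamma> (first_order_op \<alpha> \<gamma> a u y) (snd p)) x) $ p
      = (lam None x *\<^sub>R ((\<Sum>i\<in>UNIV. a i x *\<^sub>R dW i) + partial None (a None) x *\<^sub>R W x)) $ p"
      by (simp add: p coord dF lam mult.assoc)
  qed
  also have "\<dots> \<in> K"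
    by (intro subspace_scale subspace_add subspace_sum K dW W x)
  finally show "cauchy_riemann_op \<alpha> \<gamma> lam (first_order_op \<alpha> \<gamma> a u) x = \<zero>\<^bsub>clifford_algebra \<alpha> \<gamma>\<^esub>"
    by (simp add: cauchy_riemann_op_eq_zero_iff K_def)
qed

end
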